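(* Let $\mathsf X$ be a classical metric space. Among the subsets of the Isbell completion $I(\mathsf X)$ that contain the image of $\mathsf X$ under the Yoneda map $x\mapsto(d(-,x),d(x,-))$ and on which the generalized metric of $I(\mathsf X)$ restricts to a classical metric, there is a largest one, and it is isometric to the tight span $T(\mathsf X)$.
   Context: A classical metric space is a metric space in the usual sense (finite, symmetric, separated distances). A generalized metric space is a set $X$ with $d_X\colon X\times X\to[0,\infty]$ such that $d_X(x,x)=0$ and $d_X(x,y)+d_X(y,z)\ge d_X(x,z)$ for all $x,y,z$. For $a,b\in[0,\infty]$ write $b\dot{-}a:=\max(b-a,0)$ (with $\infty\dot{-}\infty=0$). For a generalized metric space $X$, a presheaf is a function $f\colon X\to[0,\infty]$ with $d_X(x,x')\ge f(x)\dot{-}f(x')$ for all $x,x'$; the space $\widehat X$ of presheaves has generalized metric $d_{\widehat X}(f,f')=\sup_{x}(f'(x)\dot{-}f(x))$. A co-presheaf is a function $g\colon X\to[0,\infty]$ with $d_X(x,x')\ge g(x')\dot{-}g(x)$; the space $\check X^{\mathrm{op}}$ of op-co-presheaves has generalized metric $d_{\check X^{\mathrm{op}}}(g,g')=\sup_x(g(x)\dot{-}g'(x))$. Define $L(f)(y)=\sup_{x\in X}(d_X(x,y)\dot{-}f(x))$ for $f\in\widehat X$ and $R(g)(x)=\sup_{y\in X}(d_X(x,y)\dot{-}g(y))$ for $g\in\check X^{\mathrm{op}}$. The Isbell completion is $I(X)=\{(f,g)\in\widehat X\times\check X^{\mathrm{op}}\mid L(f)=g,\ R(g)=f\}$ with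 generalized metric $d_{I(X)}((f,g),(f',g'))=\max\{d_{\widehat X}(f,f'),\,d_{\check X^{\mathrm{op}}}(g,g')\}$. For a classical metric space $\mathsf X$, the tight span is $T(\mathsf X)=\{f\in\widehat{\mathsf X}\mid f(x)=\sup_{y\in\mathsf X}(d(x,y)\dot{-}f(y))\text{ for all }x\in\mathsf X\}$ with the generalized metric induced from $\widehat{\mathsf X}$. *)

theory Defs
  imports "HOL-Analysis.Analysis"
begin

text \<open>
  Spaces are explicit carriers (possibly empty). Functions on a carrier are extensional, so that
  equality of functions is equality on the carrier. Distances take values in \<^typ>\<open>ennreal\<close>.
\<close>

section \<open>Generalized and classical metrics\<close>

definition generalized_metric :: "'a set \<Rightarrow> ('a \<Rightarrow> 'a \<Rightarrow> ennreal) \<Rightarrow> bool" where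
  "generalized_metric X d \<longleftrightarrow>
     (\<forall>x\<in>X. d x x = 0) \<and>
     (\<forall>x\<in>X. \<forall>y\<in>X. \<forall>z\<in>X. d x z \<le> d x y + d y z)"

definition classical_metric :: "'a set \<Rightarrow> ('a \<Rightarrow> 'a \<Rightarrow> ennreal) \<Rightarrow> bool" where
  "classical_metric X d \<longleftrightarrow>
     generalized_metric X d \<and>
     (\<forall>x\<in>X. \<forall>y\<in>X. d x y < \<infinity>) \<and>
     (\<forall>x\<in>X. \<forall>y\<in>X. d x y = d y x) \<and>
     (\<forall>x\<in>X. \<forall>y\<in>X. d x y = 0 \<longrightarrow> x = y)"

definition metric_ennreal :: "('a \<Rightarrow> 'a \<Rightarrow> real) \<Rightarrow> 'a \<Rightarrow> 'a \<Rightarrow> ennreal" where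
  "metric_ennreal d = (\<lambda>x y. ennreal (d x y))"

text \<open>
  The classical metrics are exactly those coming from \<^locale>\<open>Metric_space\<close>. That locale asks for
  nonnegativity and symmetry off the carrier too, hence the auxiliary \<open>e\<close>.
\<close>

lemma classical_metric_metric_ennreal:
  assumes "Metric_space X e"
  shows "classical_metric X (metric_ennreal e)"
proof -
  interpret Metric_space X e by fact
  show ?thesis
    by (auto simp: classical_metric_def generalized_metric_def metric_ennreal_def commute
             simp flip: ennreal_plus intro!: ennreal_leI triangle)
qed

lemma classical_metric_iff_Metric_space:
  "classical_metric X d \<longleftrightarrow>
     (\<exists>e. Metric_space X e \<and> (\<forall>x\<in>X. \<forall>y\<in>X. d x y = metric_ennreal e x y))"
proof
  assume d: "classical_metric X d"
  define e where "e x y = (if x \<in> X \<and> y \<in> X then enn2real (d x y) else 0)" for x y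
  have de: "d x y = ennreal (e x y)" if "x \<in> X" "y \<in> X" for x y
    using d that by (auto simp: e_def classical_metric_def less_top)
  have nn: "0 \<le> e x y" for x y
    by (simp add: e_def)
  have "Metric_space X e"
  proof
    show "0 \<le> e x y" for x y by (rule nn)
    show "e x y = e y x" for x y
      using d by (auto simp: e_def classical_metric_def)
    show "e x y = 0 \<longleftrightarrow> x = y" if "x \<in> X" "y \<in> X" for x y
      using d de[OF that] that
      by (metis classical_metric_def generalized_metric_def ennreal_0 ennreal_eq_0_iff nn order_antisym
          order_refl)
    show "e x z \<le> e x y + e y z" if "x \<in> X" "y \<in> X" "z \<in> X" for x y z
    proof -
      have "ennreal (e x z) \<le> ennreal (e x y + e y z)"
        using d that by (simp add: classical_metric_def generalized_metric_def nn flip: de)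
      then show ?thesis by (metis nn add_nonneg_nonneg ennreal_le_iff)
    qed
  qed
  then show "\<exists>e. Metric_space X e \<and> (\<forall>x\<in>X. \<forall>y\<in>X. d x y = metric_ennreal e x y)"
    using de by (auto simp: metric_ennreal_def)
next
  assume "\<exists>e. Metric_space X e \<and> (\<forall>x\<in>X. \<forall>y\<in>X. d x y = metric_ennreal e x y)"
  then obtain e where "Metric_space X e" and de: "\<And>x y. x \<in> X \<Longrightarrow> y \<in> X \<Longrightarrow> d x y = metric_ennreal e x y"
    by auto
  then have "classical_metric X (metric_ennreal e)"
    by (simp add: classical_metric_metric_ennreal)
  then show "classical_metric X d"
    by (simp add: classical_metric_def generalized_metric_def de)
qed

definition isometric ::
  "'a set \<Rightarrow> ('a \<Rightarrow> 'a \<Rightarrow> ennreal) \<Rightarrow> 'b set \<Rightarrow> ('b \<Rightarrow> 'b \<Rightarrow> ennreal) \<Rightarrow> bool" where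
  "isometric A dA B dB \<longleftrightarrow>
     (\<exists>\<phi>. bij_betw \<phi> A B \<and> (\<forall>x\<in>A. \<forall>y\<in>A. dB (\<phi> x) (\<phi> y) = dA x y))"

section \<open>Presheaves, Isbell completion and tight span\<close>

text \<open>
  The case distinction is needed: \<^term>\<open>\<infinity> - \<infinity> :: ennreal\<close> is \<^term>\<open>\<infinity> :: ennreal\<close>, whereas
  \<open>\<infinity> \<ominus> \<infinity> = 0\<close>.
\<close>

definition tsub :: "ennreal \<Rightarrow> ennreal \<Rightarrow> ennreal" (infixl "\<ominus>" 65) where
  "b \<ominus> a = (if b \<le> a then 0 else b - a)"

lemma tsub_ennreal: "0 \<le> a \<Longrightarrow> 0 \<le> b \<Longrightarrow> ennreal b \<ominus> ennreal a = ennreal (max (b - a) 0)"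
  by (auto simp: tsub_def ennreal_minus max_def)

lemma tsub_top [simp]: "b \<ominus> \<infinity> = 0" "a < \<infinity> \<Longrightarrow> \<infinity> \<ominus> a = \<infinity>"
  by (auto simp: tsub_def top_unique)

definition presheaves :: "'a set \<Rightarrow> ('a \<Rightarrow> 'a \<Rightarrow> ennreal) \<Rightarrow> ('a \<Rightarrow> ennreal) set" where
  "presheaves X d = {f \<in> extensional X. \<forall>x\<in>X. \<forall>x'\<in>X. d x x' \<ge> f x \<ominus> f x'}"

definition presheaf_dist :: "'a set \<Rightarrow> ('a \<Rightarrow> ennreal) \<Rightarrow> ('a \<Rightarrow> ennreal) \<Rightarrow> ennreal" where
  "presheaf_dist X f f' = (SUP x\<in>X. f' x \<ominus> f x)"

definition copresheaves :: "'a set \<Rightarrow> ('a \<Rightarrow> 'a \<Rightarrow> ennreal) \<Rightarrow> ('a \<Rightarrow> ennreal) set" where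
  "copresheaves X d = {g \<in> extensional X. \<forall>x\<in>X. \<forall>x'\<in>X. d x x' \<ge> g x' \<ominus> g x}"

definition op_copresheaf_dist :: "'a set \<Rightarrow> ('a \<Rightarrow> ennreal) \<Rightarrow> ('a \<Rightarrow> ennreal) \<Rightarrow> ennreal" where
  "op_copresheaf_dist X g g' = (SUP x\<in>X. g x \<ominus> g' x)"

definition isbell_L :: "'a set \<Rightarrow> ('a \<Rightarrow> 'a \<Rightarrow> ennreal) \<Rightarrow> ('a \<Rightarrow> ennreal) \<Rightarrow> 'a \<Rightarrow> ennreal" where
  "isbell_L X d f = (\<lambda>y\<in>X. SUP x\<in>X. d x y \<ominus> f x)"

definition isbell_R :: "'a set \<Rightarrow> ('a \<Rightarrow> 'a \<Rightarrow> ennreal) \<Rightarrow> ('a \<Rightarrow> ennreal) \<Rightarrow> 'a \<Rightarrow> ennreal" where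
  "isbell_R X d g = (\<lambda>x\<in>X. SUP y\<in>X. d x y \<ominus> g y)"

definition isbell_completion ::
  "'a set \<Rightarrow> ('a \<Rightarrow> 'a \<Rightarrow> ennreal) \<Rightarrow> (('a \<Rightarrow> ennreal) \<times> ('a \<Rightarrow> ennreal)) set" where
  "isbell_completion X d =
     {(f, g). f \<in> presheaves X d \<and> g \<in> copresheaves X d \<and> isbell_L X d f = g \<and> isbell_R X d g = f}"

definition isbell_dist ::
  "'a set \<Rightarrow> ('a \<Rightarrow> ennreal) \<times> ('a \<Rightarrow> ennreal) \<Rightarrow> ('a \<Rightarrow> ennreal) \<times> ('a \<Rightarrow> ennreal) \<Rightarrow> ennreal" where
  "isbell_dist X p q = max (presheaf_dist X (fst p) (fst q)) (op_copresheaf_dist X (snd p) (snd q))"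

definition yoneda ::
  "'a set \<Rightarrow> ('a \<Rightarrow> 'a \<Rightarrow> ennreal) \<Rightarrow> 'a \<Rightarrow> ('a \<Rightarrow> ennreal) \<times> ('a \<Rightarrow> ennreal)" where
  "yoneda X d x = (\<lambda>z\<in>X. d z x, \<lambda>z\<in>X. d x z)"

definition tight_span :: "'a set \<Rightarrow> ('a \<Rightarrow> 'a \<Rightarrow> ennreal) \<Rightarrow> ('a \<Rightarrow> ennreal) set" where
  "tight_span X d = {f \<in> presheaves X d. \<forall>x\<in>X. f x = (SUP y\<in>X. d x y \<ominus> f y)}"

definition classical_subspaces ::
  "'a set \<Rightarrow> ('a \<Rightarrow> 'a \<Rightarrow> ennreal) \<Rightarrow> (('a \<Rightarrow> ennreal) \<times> ('a \<Rightarrow> ennreal)) set set" where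
  "classical_subspaces X d =
     {S. S \<subseteq> isbell_completion X d \<and> yoneda X d ` X \<subseteq> S \<and> classical_metric S (isbell_dist X)}"

end

theory Submission
  imports Defs
begin

text \<open>
  The largest subset is the diagonal \<open>{(f, f) | f \<in> T(X)}\<close>, and the projection \<open>(f, f) \<mapsto> f\<close> is the
  isometry. Everything rests on two general facts about the Isbell completion.

  First, \<open>L\<close> and \<open>R\<close> reverse direction without increasing distances. As they are mutually inverse on
  \<open>I(X)\<close>, the two distances in the maximum defining \<open>d\<^bsub>I(X)\<^esub>\<close> are equal
  (\<open>isbell_components_dist_eq\<close>). On a diagonal pair this makes the presheaf distance symmetric, so that
  the metric of \<open>I(X)\<close> agrees with that of \<open>T(X)\<close> there.

  Secondly, by the Yoneda lemma, the distance from the image of \<open>x\<close> to \<open>(f, g)\<close> is \<open>f(x)\<close> and the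
  distance back is \<open>g(x)\<close> (\<open>isbell_dist_yoneda\<close>). A subset that contains the Yoneda image and has a
  symmetric metric therefore consists of pairs with \<open>f = g\<close>, and for these the equation
  \<open>R(g) = f\<close> says precisely that \<open>f \<in> T(X)\<close>. Conversely, diagonal pairs have finite distances: a route
  through the image of \<open>x\<close> gives the bound \<open>f(x) + f'(x)\<close>, and the members of \<open>T(X)\<close> have only finite
  values.
\<close>

section \<open>Truncated subtraction and the metric of the Isbell completion\<close>

text \<open>
  Truncated subtraction is left adjoint to addition, even at \<open>\<infinity>\<close>. All estimates below are made on the
  additive side, where no case distinctions occur.
\<close>

lemma tsub_le_iff: "b \<ominus> a \<le> c \<longleftrightarrow> b \<le> c + a"
proof (cases "b \<le> a")
  case True
  then show ?thesis by (simp add: tsub_def add_increasing)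
next
  case False
  then have "a \<noteq> \<infinity>" by auto
  with False show ?thesis
    by (auto simp: tsub_def ennreal_minus_le_iff add.commute)
qed

lemma presheaf_dist_le_iff: "presheaf_dist X f f' \<le> c \<longleftrightarrow> (\<forall>x\<in>X. f' x \<le> c + f x)"
  by (simp add: presheaf_dist_def SUP_le_iff tsub_le_iff)

lemma presheaf_dist_bound: "x \<in> X \<Longrightarrow> f' x \<le> presheaf_dist X f f' + f x"
  using presheaf_dist_le_iff[of X f f' "presheaf_dist X f f'"] by simp

lemma presheaf_dist_refl: "presheaf_dist X f f = 0"
  using presheaf_dist_le_iff[of X f f 0] by simp

lemma presheaf_dist_triangle:
  "presheaf_dist X f h \<le> presheaf_dist X f g + presheaf_dist X g h"
proof (unfold presheaf_dist_le_iff, intro ballI)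
  fix x assume x: "x \<in> X"
  have "h x \<le> presheaf_dist X g h + g x"
    using x by (rule presheaf_dist_bound)
  also have "\<dots> \<le> presheaf_dist X g h + (presheaf_dist X f g + f x)"
    using x by (intro add_left_mono presheaf_dist_bound)
  finally show "h x \<le> presheaf_dist X f g + presheaf_dist X g h + f x"
    by (simp add: ac_simps)
qed

lemma op_copresheaf_dist_eq: "op_copresheaf_dist X g g' = presheaf_dist X g' g"
  by (simp add: op_copresheaf_dist_def presheaf_dist_def)

lemma generalized_metric_isbell_dist: "generalized_metric S (isbell_dist X)"
proof -
  have "isbell_dist X p r \<le> isbell_dist X p q + isbell_dist X q r" for p q r
    unfolding isbell_dist_def op_copresheaf_dist_eq
  proof (rule max.boundedI)
    show "presheaf_dist X (fst p) (fst r)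
        \<le> max (presheaf_dist X (fst p) (fst q)) (presheaf_dist X (snd q) (snd p)) +
          max (presheaf_dist X (fst q) (fst r)) (presheaf_dist X (snd r) (snd q))"
      by (rule order_trans[OF presheaf_dist_triangle[where g = "fst q"]]) (intro add_mono; simp)
    show "presheaf_dist X (snd r) (snd p)
        \<le> max (presheaf_dist X (fst p) (fst q)) (presheaf_dist X (snd q) (snd p)) +
          max (presheaf_dist X (fst q) (fst r)) (presheaf_dist X (snd r) (snd q))"
      by (rule order_trans[OF presheaf_dist_triangle[where g = "snd q"]], subst add.commute)
        (intro add_mono; simp)
  qed
  then show ?thesis
    by (simp add: generalized_metric_def isbell_dist_def op_copresheaf_dist_eq presheaf_dist_refl)
qed

section \<open>Isbell duality\<close>

lemma presheaves_iff:
  "f \<in> presheaves X d \<longleftrightarrow> f \<in> extensional X \<and> (\<forall>x\<in>X. \<forall>x'\<in>X. f x \<le> d x x' + f x')"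
  by (simp add: presheaves_def tsub_le_iff)

text \<open>Passing to the opposite space exchanges the two sides of Isbell duality.\<close>

lemma copresheaves_eq_presheaves: "copresheaves X d = presheaves X (\<lambda>x y. d y x)"
  by (auto simp: copresheaves_def presheaves_def)

lemma isbell_R_eq_isbell_L: "isbell_R X d = isbell_L X (\<lambda>x y. d y x)"
  by (simp add: isbell_R_def isbell_L_def fun_eq_iff)

lemma isbell_L_le_iff: "y \<in> X \<Longrightarrow> isbell_L X d f y \<le> c \<longleftrightarrow> (\<forall>x\<in>X. d x y \<le> c + f x)"
  by (simp add: isbell_L_def SUP_le_iff tsub_le_iff)

lemma isbell_L_bound: "x \<in> X \<Longrightarrow> y \<in> X \<Longrightarrow> d x y \<le> isbell_L X d f y + f x"
  using isbell_L_le_iff[of y X d f "isbell_L X d f y"] by simp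

text \<open>
  If \<open>f' \<le> c + f\<close>, then the upper bounds \<open>d x y \<le> L(f')(y) + f' x\<close> give
  \<open>d x y \<le> (c + L(f')(y)) + f x\<close>, and \<open>L(f)(y)\<close> is the least number with this property.
\<close>

lemma isbell_L_nonexpansive:
  "presheaf_dist X (isbell_L X d f') (isbell_L X d f) \<le> presheaf_dist X f f'"
proof (unfold presheaf_dist_le_iff, intro ballI)
  fix y assume y: "y \<in> X"
  have "d x y \<le> presheaf_dist X f f' + isbell_L X d f' y + f x" if x: "x \<in> X" for x
  proof -
    have "d x y \<le> isbell_L X d f' y + f' x"
      using x y by (rule isbell_L_bound)
    also have "\<dots> \<le> isbell_L X d f' y + (presheaf_dist X f f' + f x)"
      using x by (intro add_left_mono presheaf_dist_bound)
    finally show ?thesis by (simp add: ac_simps)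
  qed
  then show "isbell_L X d f y \<le> presheaf_dist X f f' + isbell_L X d f' y"
    using y by (simp add: isbell_L_le_iff)
qed

text \<open>
  One inequality comes from \<open>L\<close>, the other from \<open>R\<close>, which is \<open>L\<close> for the opposite space.
\<close>

lemma isbell_components_dist_eq:
  assumes "(f, g) \<in> isbell_completion X d" "(f', g') \<in> isbell_completion X d"
  shows "presheaf_dist X f f' = presheaf_dist X g' g"
proof (rule antisym)
  show "presheaf_dist X g' g \<le> presheaf_dist X f f'"
    using assms isbell_L_nonexpansive[of X d f' f] by (simp add: isbell_completion_def)
  show "presheaf_dist X f f' \<le> presheaf_dist X g' g"
    using assms isbell_L_nonexpansive[of X "\<lambda>x y. d y x" g g']
    by (simp add: isbell_completion_def isbell_R_eq_isbell_L)
qed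

lemma isbell_dist_eq_presheaf_dist:
  assumes "(f, g) \<in> isbell_completion X d" "(f', g') \<in> isbell_completion X d"
  shows "isbell_dist X (f, g) (f', g') = presheaf_dist X f f'"
  using isbell_components_dist_eq[OF assms] by (simp add: isbell_dist_def op_copresheaf_dist_eq)

section \<open>The Yoneda embedding\<close>

text \<open>
  The Yoneda lemma: a presheaf exceeds the representable presheaf of \<open>x\<close> most at \<open>x\<close> itself.
\<close>

lemma presheaf_dist_representable:
  assumes d: "generalized_metric X d" and f: "f \<in> presheaves X d" and x: "x \<in> X"
  shows "presheaf_dist X (\<lambda>z\<in>X. d z x) f = f x"
proof (rule antisym)
  show "presheaf_dist X (\<lambda>z\<in>X. d z x) f \<le> f x"
    using f x by (simp add: presheaf_dist_le_iff presheaves_iff add.commute)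
  show "f x \<le> presheaf_dist X (\<lambda>z\<in>X. d z x) f"
    using presheaf_dist_bound[OF x, of f "\<lambda>z\<in>X. d z x"] d x by (simp add: generalized_metric_def)
qed

lemma generalized_metric_flip: "generalized_metric X d \<Longrightarrow> generalized_metric X (\<lambda>x y. d y x)"
  unfolding generalized_metric_def by (metis add.commute)

lemma representable_mem_presheaves:
  "generalized_metric X d \<Longrightarrow> x \<in> X \<Longrightarrow> (\<lambda>z\<in>X. d z x) \<in> presheaves X d"
  by (simp add: presheaves_iff generalized_metric_def)

lemma isbell_L_representable:
  assumes d: "generalized_metric X d" and x: "x \<in> X"
  shows "isbell_L X d (\<lambda>z\<in>X. d z x) = (\<lambda>z\<in>X. d x z)"
proof (rule extensionalityI[of _ X])
  fix y assume y: "y \<in> X"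
  show "isbell_L X d (\<lambda>z\<in>X. d z x) y = (\<lambda>z\<in>X. d x z) y"
  proof (rule antisym)
    show "isbell_L X d (\<lambda>z\<in>X. d z x) y \<le> (\<lambda>z\<in>X. d x z) y"
      using d x y by (simp add: isbell_L_le_iff generalized_metric_def add.commute)
    show "(\<lambda>z\<in>X. d x z) y \<le> isbell_L X d (\<lambda>z\<in>X. d z x) y"
      using isbell_L_bound[OF x y, of d "\<lambda>z\<in>X. d z x"] d x y by (simp add: generalized_metric_def)
  qed
qed (auto simp: isbell_L_def)

lemma yoneda_mem_isbell_completion:
  assumes d: "generalized_metric X d" and x: "x \<in> X"
  shows "yoneda X d x \<in> isbell_completion X d"
  using representable_mem_presheaves[OF d x] isbell_L_representable[OF d x]
    representable_mem_presheaves[OF generalized_metric_flip[OF d] x]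
    isbell_L_representable[OF generalized_metric_flip[OF d] x]
  by (simp add: yoneda_def isbell_completion_def copresheaves_eq_presheaves isbell_R_eq_isbell_L)

lemma isbell_dist_yoneda:
  assumes d: "generalized_metric X d" and fg: "(f, g) \<in> isbell_completion X d" and x: "x \<in> X"
  shows "isbell_dist X (yoneda X d x) (f, g) = f x" "isbell_dist X (f, g) (yoneda X d x) = g x"
proof -
  have y: "((\<lambda>z\<in>X. d z x), (\<lambda>z\<in>X. d x z)) \<in> isbell_completion X d"
    using yoneda_mem_isbell_completion[OF d x] by (simp add: yoneda_def)
  show "isbell_dist X (yoneda X d x) (f, g) = f x"
    using presheaf_dist_representable[OF d _ x] fg
    by (simp add: yoneda_def isbell_dist_eq_presheaf_dist[OF y fg] isbell_completion_def)
  show "isbell_dist X (f, g) (yoneda X d x) = g x"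
    using presheaf_dist_representable[OF generalized_metric_flip[OF d] _ x] fg
    by (simp add: yoneda_def isbell_dist_eq_presheaf_dist[OF fg y] isbell_components_dist_eq[OF fg y]
        isbell_completion_def copresheaves_eq_presheaves)
qed

section \<open>The tight span as the diagonal of the Isbell completion\<close>

lemma tight_span_iff:
  "f \<in> tight_span X d \<longleftrightarrow> f \<in> presheaves X d \<and> isbell_R X d f = f"
  by (auto simp: tight_span_def isbell_R_def presheaves_def fun_eq_iff extensional_def)

text \<open>
  In a symmetric space presheaves are the same as co-presheaves and \<open>L\<close> is the same as \<open>R\<close>, so that the
  two equations defining the completion reduce to one on the diagonal.
\<close>

lemma diagonal_mem_isbell_completion_iff:
  assumes "\<And>x y. x \<in> X \<Longrightarrow> y \<in> X \<Longrightarrow> d x y = d y x"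
  shows "(f, f) \<in> isbell_completion X d \<longleftrightarrow> f \<in> tight_span X d"
proof -
  have "f \<in> copresheaves X d \<longleftrightarrow> f \<in> presheaves X d"
    using assms by (auto simp: copresheaves_eq_presheaves presheaves_def)
  moreover have "isbell_L X d f = isbell_R X d f"
    using assms by (auto simp: isbell_L_def isbell_R_def intro!: restrict_ext SUP_cong)
  ultimately show ?thesis by (auto simp: isbell_completion_def tight_span_iff)
qed

text \<open>
  In a space with finite distances, a presheaf with one infinite value is constantly \<open>\<infinity>\<close>; but then
  the equation defining the tight span would give it the value \<open>0\<close>.
\<close>

lemma tight_span_finite:
  assumes d: "\<And>x y. x \<in> X \<Longrightarrow> y \<in> X \<Longrightarrow> d x y < \<infinity>" and f: "f \<in> tight_span X d" and x: "x \<in> X"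
  shows "f x < \<infinity>"
proof (rule ccontr)
  assume "\<not> f x < \<infinity>"
  then have top: "f x = \<infinity>" by (simp add: less_top[symmetric])
  have "f y = \<infinity>" if y: "y \<in> X" for y
  proof -
    have "f x \<le> d x y + f y"
      using f x y unfolding tight_span_iff presheaves_iff by blast
    then show ?thesis using d[OF x y] top by (auto simp: top_unique)
  qed
  then have "(SUP y\<in>X. d x y \<ominus> f y) = (SUP y\<in>X. 0)"
    by (intro SUP_cong) (simp_all add: tsub_def)
  also have "\<dots> = 0" using x by (subst SUP_constant) (auto simp: bot_ennreal)
  finally have "(SUP y\<in>X. d x y \<ominus> f y) = 0" .
  moreover have "f x = (SUP y\<in>X. d x y \<ominus> f y)"
    using f x unfolding tight_span_def by blast
  ultimately show False using top by simp
qed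

lemma classical_metric_diagonal:
  assumes d: "classical_metric X d"
  shows "classical_metric ((\<lambda>f. (f, f)) ` tight_span X d) (isbell_dist X)"
proof -
  have gen: "generalized_metric X d" and fin: "\<And>x y. x \<in> X \<Longrightarrow> y \<in> X \<Longrightarrow> d x y < \<infinity>"
    and sym: "\<And>x y. x \<in> X \<Longrightarrow> y \<in> X \<Longrightarrow> d x y = d y x"
    using d by (simp_all add: classical_metric_def)
  note diag = diagonal_mem_isbell_completion_iff[of X d, OF sym, THEN iffD2]
  have finite: "isbell_dist X (f, f) (f', f') < \<infinity>"
    if f: "f \<in> tight_span X d" and f': "f' \<in> tight_span X d" for f f'
  proof (cases "X = {}")
    case True
    then show ?thesis by (simp add: isbell_dist_def presheaf_dist_def op_copresheaf_dist_def
          bot_ennreal)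
  next
    case False
    then obtain x where x: "x \<in> X" by auto
    have "isbell_dist X (f, f) (f', f')
        \<le> isbell_dist X (f, f) (yoneda X d x) + isbell_dist X (yoneda X d x) (f', f')"
      using generalized_metric_isbell_dist[of UNIV X]
      unfolding generalized_metric_def by blast
    also have "\<dots> = f x + f' x"
      using diag[OF _ _ f] diag[OF _ _ f'] x by (simp add: isbell_dist_yoneda[OF gen])
    also have "\<dots> < \<infinity>"
      using tight_span_finite[of X d f, OF fin f x] tight_span_finite[of X d f', OF fin f' x] by simp
    finally show ?thesis .
  qed
  have separated: "f = f'"
    if "f \<in> tight_span X d" "f' \<in> tight_span X d" "isbell_dist X (f, f) (f', f') = 0" for f f'
  proof (rule extensionalityI[of _ X])
    have "presheaf_dist X f f' = 0" "presheaf_dist X f' f = 0"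
      using that(3) by (simp_all add: isbell_dist_def op_copresheaf_dist_eq max_def split: if_splits)
    then show "f x = f' x" if "x \<in> X" for x
      using presheaf_dist_bound[OF that, of f' f] presheaf_dist_bound[OF that, of f f']
      by (auto intro: antisym)
  qed (use that in \<open>simp_all add: tight_span_iff presheaves_def\<close>)
  show ?thesis
    using finite separated
    by (auto simp: classical_metric_def generalized_metric_isbell_dist
        isbell_dist_def op_copresheaf_dist_eq max.commute)
qed

text \<open>
  The values \<open>f(x)\<close> and \<open>g(x)\<close> are the distances from and to the image of \<open>x\<close>, which lies in \<open>S\<close>,
  so symmetry on \<open>S\<close> forces \<open>f = g\<close>.
\<close>

lemma classical_subspace_subset_diagonal:
  assumes d: "classical_metric X d" and S: "S \<in> classical_subspaces X d"
  shows "S \<subseteq> (\<lambda>f. (f, f)) ` tight_span X d"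
proof (rule subrelI)
  fix f g assume fg: "(f, g) \<in> S"
  have gen: "generalized_metric X d" and sym: "\<And>x y. x \<in> X \<Longrightarrow> y \<in> X \<Longrightarrow> d x y = d y x"
    using d by (simp_all add: classical_metric_def)
  have I: "(f, g) \<in> isbell_completion X d"
    using S fg by (auto simp: classical_subspaces_def)
  have "f = g"
  proof (rule extensionalityI[of _ X])
    fix x assume x: "x \<in> X"
    have "isbell_dist X (yoneda X d x) (f, g) = isbell_dist X (f, g) (yoneda X d x)"
      using S fg x by (auto simp: classical_subspaces_def classical_metric_def)
    then show "f x = g x" by (simp add: isbell_dist_yoneda[OF gen I x])
  qed (use I in \<open>auto simp: isbell_completion_def presheaves_def copresheaves_def\<close>)
  then show "(f, g) \<in> (\<lambda>f. (f, f)) ` tight_span X d"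
    using I diagonal_mem_isbell_completion_iff[of X d f, OF sym] by auto
qed

lemma diagonal_mem_classical_subspaces:
  assumes d: "classical_metric X d"
  shows "(\<lambda>f. (f, f)) ` tight_span X d \<in> classical_subspaces X d"
proof -
  have gen: "generalized_metric X d" and sym: "\<And>x y. x \<in> X \<Longrightarrow> y \<in> X \<Longrightarrow> d x y = d y x"
    using d by (simp_all add: classical_metric_def)
  note diag = diagonal_mem_isbell_completion_iff[of X d, OF sym]
  have "yoneda X d x \<in> (\<lambda>f. (f, f)) ` tight_span X d" if x: "x \<in> X" for x
  proof -
    have "yoneda X d x = ((\<lambda>z\<in>X. d z x), (\<lambda>z\<in>X. d z x))"
      using x sym by (auto simp: yoneda_def intro: restrict_ext)
    then show ?thesis
      using yoneda_mem_isbell_completion[OF gen x] diag by auto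
  qed
  then show ?thesis
    using classical_metric_diagonal[OF d] diag by (auto simp: classical_subspaces_def)
qed

lemma isometric_diagonal_tight_span:
  assumes sym: "\<And>x y. x \<in> X \<Longrightarrow> y \<in> X \<Longrightarrow> d x y = d y x"
  shows "isometric ((\<lambda>f. (f, f)) ` tight_span X d) (isbell_dist X)
           (tight_span X d) (presheaf_dist X)"
  unfolding isometric_def
proof (intro exI conjI ballI)
  show "bij_betw fst ((\<lambda>f. (f, f)) ` tight_span X d) (tight_span X d)"
    by (auto simp: bij_betw_def inj_on_def image_image)
  fix p q
  assume "p \<in> (\<lambda>f. (f, f)) ` tight_span X d" "q \<in> (\<lambda>f. (f, f)) ` tight_span X d"
  then obtain f f' where "p = (f, f)" "q = (f', f')" "f \<in> tight_span X d" "f' \<in> tight_span X d"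
    by auto
  then show "presheaf_dist X (fst p) (fst q) = isbell_dist X p q"
    using isbell_dist_eq_presheaf_dist[of f f X d f' f']
      diagonal_mem_isbell_completion_iff[of X d, OF sym] by simp
qed

theorem theorem6:
  fixes X :: "'a set" and d :: "'a \<Rightarrow> 'a \<Rightarrow> real"
  assumes "Metric_space X d"
  shows "\<exists>M \<in> classical_subspaces X (metric_ennreal d).
           (\<forall>S \<in> classical_subspaces X (metric_ennreal d). S \<subseteq> M) \<and>
           isometric M (isbell_dist X) (tight_span X (metric_ennreal d)) (presheaf_dist X)"
proof -
  have d: "classical_metric X (metric_ennreal d)"
    using assms by (rule classical_metric_metric_ennreal)
  then have sym: "\<And>x y. x \<in> X \<Longrightarrow> y \<in> X \<Longrightarrow> metric_ennreal d x y = metric_ennreal d y x"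
    by (simp add: classical_metric_def)
  show ?thesis
    using diagonal_mem_classical_subspaces[OF d] classical_subspace_subset_diagonal[OF d]
      isometric_diagonal_tight_span[of X "metric_ennreal d", OF sym]
    by blast
qed

end
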